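(* Let $n,m\ge1$, $\mathbf a\in\Delta_n$, $\mathbf b\in\Delta_m$, and let $\mathbf L=(L_{ijkl})$ be a symmetric real 4D tensor with $(i,j),(k,l)\in\{1,\dots,n\}\times\{1,\dots,m\}$. Let $\mathbf P^\star$ be an optimal solution of $\min_{\mathbf P\in\Pi(\mathbf a,\mathbf b)}\langle\mathbf L\otimes\mathbf P,\mathbf P\rangle$ and let $\mathbf C=\mathbf L\otimes\mathbf P^\star\in\mathbb R^{n\times m}$. Then for every integer $N\ge1$, all $(i_1,j_1),\dots,(i_N,j_N)\in\operatorname{supp}(\mathbf P^\star)$ and every permutation $\sigma$ of $\{1,\dots,N\}$, $$\sum_{k=1}^N C_{i_kj_k}\le\sum_{k=1}^N C_{i_kj_{\sigma(k)}} .$$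
   Context: $\Delta_n=\{\mathbf a\in\mathbb R_+^n:\sum_{i=1}^n a_i=1\}$. $\Pi(\mathbf a,\mathbf b)=\{\mathbf P\in\mathbb R_+^{n\times m}:\mathbf P\mathbf 1_m=\mathbf a,\ \mathbf P^\top\mathbf 1_n=\mathbf b\}$, where $\mathbf 1_n$ is the all-ones vector of $\mathbb R^n$. $\langle\mathbf A,\mathbf B\rangle=\sum_{ij}A_{ij}B_{ij}$. $\mathbf L\otimes\mathbf P$ is the $n\times m$ matrix with $(k,l)$ entry $\sum_{ij}L_{ijkl}P_{ij}$, so $\langle\mathbf L\otimes\mathbf P,\mathbf P\rangle=\sum_{ijkl}L_{ijkl}P_{ij}P_{kl}$. $\mathbf L$ is symmetric if $L_{ijkl}=L_{klij}$ for all $i,j,k,l$. $\operatorname{supp}(\mathbf P)=\{(i,j):P_{ij}>0\}$. *)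

theory Defs
  imports "HOL-Analysis.Analysis"
begin

(* R^n is real^'n and R^(n x m) is real^'m^'n (row index 'n), with n = CARD('n) and
   m = CARD('m) arbitrary positive integers.  The library inner product on real^'m^'n
   is the entrywise one, sum over i, j of A $ i $ j * B $ i $ j, and 1 :: real^'n is the
   all-ones vector. *)

definition prob_simplex :: "(real^'n) set" where
  "prob_simplex = {a. (\<forall>i. 0 \<le> a $ i) \<and> (\<Sum>i\<in>UNIV. a $ i) = 1}"

definition couplings :: "real^'n \<Rightarrow> real^'m \<Rightarrow> (real^'m^'n) set" where
  "couplings a b = {P. (\<forall>i j. 0 \<le> P $ i $ j) \<and> P *v 1 = a \<and> transpose P *v 1 = b}"

type_synonym ('n, 'm) tensor4 = "real^'m^'n^'m^'n"

definition symmetric_tensor :: "('n::finite, 'm::finite) tensor4 \<Rightarrow> bool" where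
  "symmetric_tensor L \<longleftrightarrow> (\<forall>i j k l. L $ i $ j $ k $ l = L $ k $ l $ i $ j)"

definition tensor_matrix_mult ::
    "('n::finite, 'm::finite) tensor4 \<Rightarrow> real^'m^'n \<Rightarrow> real^'m^'n" where
  "tensor_matrix_mult L P =
     (\<chi> k l. \<Sum>i\<in>UNIV. \<Sum>j\<in>UNIV. L $ i $ j $ k $ l * P $ i $ j)"

definition optimal_coupling ::
    "('n::finite, 'm::finite) tensor4 \<Rightarrow> real^'n \<Rightarrow> real^'m \<Rightarrow> real^'m^'n \<Rightarrow> bool" where
  "optimal_coupling L a b P \<longleftrightarrow>
     is_arg_min (\<lambda>Q. tensor_matrix_mult L Q \<bullet> Q) (\<lambda>Q. Q \<in> couplings a b) P"

definition matrix_support :: "real^'m^'n \<Rightarrow> ('n \<times> 'm) set" where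
  "matrix_support P = {(i, j). P $ i $ j > 0}"

end

theory Submission
  imports Defs
begin

text \<open>
  Let \<open>D\<close> be the matrix that moves one unit of mass from \<open>(i\<^sub>k, j\<^sub>k)\<close> to \<open>(i\<^sub>k, j\<^sub>\<sigma>\<^sub>(\<^sub>k\<^sub>))\<close> for each \<open>k\<close>.
  Its marginals vanish and its negative entries lie on the support of \<open>P\<close>, so \<open>P + t D\<close> is a
  coupling for all small \<open>t > 0\<close>. By symmetry of \<open>L\<close> the objective there exceeds its value at \<open>P\<close>
  by \<open>2 t \<langle>C, D\<rangle> + t\<^sup>2 \<langle>L \<otimes> D, D\<rangle>\<close>; this is nonnegative by optimality, and dividing by \<open>t\<close> and
  letting \<open>t\<close> tend to \<open>0\<close> gives \<open>\<langle>C, D\<rangle> \<ge> 0\<close>.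
\<close>

lemma linear_tensor_matrix_mult: "linear (tensor_matrix_mult L)"
  by (rule linearI)
    (simp_all add: tensor_matrix_mult_def vec_eq_iff sum.distrib sum_distrib_left algebra_simps)

lemma inner_tensor_matrix_mult:
  "tensor_matrix_mult L P \<bullet> Q =
     (\<Sum>k\<in>UNIV. \<Sum>l\<in>UNIV. \<Sum>i\<in>UNIV. \<Sum>j\<in>UNIV. L $ i $ j $ k $ l * P $ i $ j * Q $ k $ l)"
  by (simp add: tensor_matrix_mult_def inner_vec_def sum_distrib_right)

text \<open>Grouping the four indices into two pairs makes this a swap of two sums, after which
  symmetry of \<open>L\<close> exchanges the pairs.\<close>

lemma tensor_matrix_mult_self_adjoint:
  fixes P Q :: "real^'m^'n"
  assumes "symmetric_tensor L"
  shows "tensor_matrix_mult L P \<bullet> Q = tensor_matrix_mult L Q \<bullet> P"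
proof -
  define f where "f = (\<lambda>x y. L $ fst x $ snd x $ fst y $ snd y * P $ fst x $ snd x * Q $ fst y $ snd y)"
  have "tensor_matrix_mult L P \<bullet> Q = (\<Sum>y\<in>UNIV \<times> UNIV. \<Sum>x\<in>UNIV \<times> UNIV. f x y)"
    by (simp add: inner_tensor_matrix_mult f_def sum.cartesian_product' del: UNIV_Times_UNIV)
  also have "\<dots> = (\<Sum>x\<in>UNIV \<times> UNIV. \<Sum>y\<in>UNIV \<times> UNIV. f x y)"
    by (rule sum.swap)
  also have "\<dots> = tensor_matrix_mult L Q \<bullet> P"
  proof -
    have "L $ i $ j $ k $ l = L $ k $ l $ i $ j" for i j k l
      using assms unfolding symmetric_tensor_def by blast
    then have "f x y = L $ fst y $ snd y $ fst x $ snd x * Q $ fst y $ snd y * P $ fst x $ snd x" for x y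
      by (simp add: f_def)
    then show ?thesis
      by (simp add: inner_tensor_matrix_mult sum.cartesian_product' del: UNIV_Times_UNIV)
  qed
  finally show ?thesis .
qed

text \<open>Self-adjointness merges the two cross terms. The factor \<open>t\<close> is pulled out
  so that it can later be divided away.\<close>

lemma tensor_quadratic_expansion:
  assumes "symmetric_tensor L"
  shows "tensor_matrix_mult L (P + t *\<^sub>R D) \<bullet> (P + t *\<^sub>R D) =
    tensor_matrix_mult L P \<bullet> P
      + t * (2 * (tensor_matrix_mult L P \<bullet> D) + t * (tensor_matrix_mult L D \<bullet> D))"
  by (simp add: linear_add[OF linear_tensor_matrix_mult] linear_scale[OF linear_tensor_matrix_mult]
      tensor_matrix_mult_self_adjoint[OF assms, of D P] inner_left_distrib inner_right_distrib
      algebra_simps)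

text \<open>On the support, entries of \<open>P\<close> are strictly positive and stay so for small
  \<open>t\<close> by continuity; off it, \<open>D\<close> cannot lower them. There are finitely
  many entries, so one threshold serves all.\<close>

lemma eventually_coupling_perturbation:
  fixes P D :: "real^'m^'n"
  assumes P: "P \<in> couplings a b"
    and rows: "D *v 1 = 0" and cols: "transpose D *v 1 = 0"
    and off_support: "\<And>u v. (u, v) \<notin> matrix_support P \<Longrightarrow> 0 \<le> D $ u $ v"
  shows "\<forall>\<^sub>F t in at_right 0. P + t *\<^sub>R D \<in> couplings a b"
proof -
  have nonneg: "\<forall>\<^sub>F t in at_right 0. 0 \<le> P $ u $ v + t * D $ u $ v" for u v
  proof (cases "(u, v) \<in> matrix_support P")
    case True
    have "((\<lambda>t. P $ u $ v + t * D $ u $ v) \<longlongrightarrow> P $ u $ v + 0 * D $ u $ v) (at_right 0)"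
      by (intro tendsto_intros)
    then have "\<forall>\<^sub>F t in at_right 0. 0 < P $ u $ v + t * D $ u $ v"
      using True by (intro order_tendstoD(1)) (auto simp: matrix_support_def)
    then show ?thesis
      by (rule eventually_mono) simp
  next
    case False
    then have "0 \<le> P $ u $ v" "0 \<le> D $ u $ v"
      using P off_support by (auto simp: couplings_def)
    then show ?thesis
      by (auto intro: eventually_at_right_less[of 0, THEN eventually_mono])
  qed
  have "\<forall>\<^sub>F t in at_right 0. \<forall>u v. 0 \<le> P $ u $ v + t * D $ u $ v"
    by (intro eventually_all_finite nonneg)
  then show ?thesis
  proof (rule eventually_mono)
    fix t assume "\<forall>u v. 0 \<le> P $ u $ v + t * D $ u $ v"
    moreover have "transpose (P + t *\<^sub>R D) = transpose P + t *\<^sub>R transpose D"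
      by (simp add: transpose_def vec_eq_iff)
    ultimately show "P + t *\<^sub>R D \<in> couplings a b"
      using P rows cols
      by (simp add: couplings_def matrix_vector_mult_add_rdistrib
          scaleR_matrix_vector_assoc[symmetric] del: transpose_matrix_vector)
  qed
qed

lemma optimal_coupling_first_order:
  fixes P D :: "real^'m^'n"
  assumes sym: "symmetric_tensor L" and opt: "optimal_coupling L a b P"
    and "D *v 1 = 0" and "transpose D *v 1 = 0"
    and "\<And>u v. (u, v) \<notin> matrix_support P \<Longrightarrow> 0 \<le> D $ u $ v"
  shows "0 \<le> tensor_matrix_mult L P \<bullet> D"
proof -
  let ?slope = "\<lambda>t. 2 * (tensor_matrix_mult L P \<bullet> D) + t * (tensor_matrix_mult L D \<bullet> D)"
  have P: "P \<in> couplings a b"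
    and min: "\<And>Q. Q \<in> couplings a b \<Longrightarrow>
      tensor_matrix_mult L P \<bullet> P \<le> tensor_matrix_mult L Q \<bullet> Q"
    using opt by (auto simp: optimal_coupling_def is_arg_min_linorder)
  have "\<forall>\<^sub>F t in at_right 0. P + t *\<^sub>R D \<in> couplings a b"
    by (rule eventually_coupling_perturbation) (use P assms in auto)
  then have "\<forall>\<^sub>F t in at_right 0. 0 \<le> ?slope t"
    using eventually_at_right_less[of 0]
  proof eventually_elim
    case (elim t)
    \<comment> \<open>The constant term of the expansion cancels against the optimal value.\<close>
    have "0 \<le> t * ?slope t"
      using min[OF elim(1)] unfolding tensor_quadratic_expansion[OF sym] by simp
    then show ?case
      using elim(2) by (simp only: zero_le_mult_iff) auto
  qed
  moreover have "(?slope \<longlongrightarrow> 2 * (tensor_matrix_mult L P \<bullet> D) + 0 * (tensor_matrix_mult L D \<bullet> D)) (at_right 0)"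
    by (intro tendsto_intros)
  ultimately have "0 \<le> 2 * (tensor_matrix_mult L P \<bullet> D) + 0 * (tensor_matrix_mult L D \<bullet> D)"
    by (intro tendsto_lowerbound) auto
  then show ?thesis
    by simp
qed

lemma unit_matrix_mult_one:
  "(axis u (axis v 1) :: real^'m^'n) *v 1 = axis u 1"
  by (auto simp: vec_eq_iff matrix_vector_mult_def axis_def if_distrib sum.delta' cong: if_cong)

lemma transpose_unit_matrix:
  "transpose (axis u (axis v 1) :: real^'m^'n) = axis v (axis u 1)"
  by (auto simp: vec_eq_iff transpose_def axis_def)

lemma sum_matrix_vector_mult:
  fixes A :: "'k \<Rightarrow> real^'m^'n"
  shows "sum A K *v x = (\<Sum>k\<in>K. A k *v x)"
  by (induction K rule: infinite_finite_induct) (simp_all add: matrix_vector_mult_add_rdistrib)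

theorem corollary4:
  fixes a :: "real^'n" and b :: "real^'m"
    and L :: "('n, 'm) tensor4"
    and P C :: "real^'m^'n"
    and N :: nat
    and i :: "nat \<Rightarrow> 'n" and j :: "nat \<Rightarrow> 'm"
    and \<sigma> :: "nat \<Rightarrow> nat"
  assumes "a \<in> prob_simplex" and "b \<in> prob_simplex"
    and "symmetric_tensor L"
    and "optimal_coupling L a b P"
    and "C = tensor_matrix_mult L P"
    and "N \<ge> 1"
    and "\<And>k. k \<in> {1..N} \<Longrightarrow> (i k, j k) \<in> matrix_support P"
    and "\<sigma> permutes {1..N}"
  shows "(\<Sum>k=1..N. C $ i k $ j k) \<le> (\<Sum>k=1..N. C $ i k $ j (\<sigma> k))"
proof -
  \<comment> \<open>\<open>E u v\<close> is a matrix unit: the outer \<open>axis\<close> selects the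
    row, the inner one the column.\<close>
  define E :: "'n \<Rightarrow> 'm \<Rightarrow> real^'m^'n" where "E u v = axis u (axis v 1)" for u v
  define D where "D = (\<Sum>k=1..N. E (i k) (j (\<sigma> k))) - (\<Sum>k=1..N. E (i k) (j k))"
  have inner_E: "A \<bullet> E u v = A $ u $ v" for A u v
    by (simp add: E_def inner_axis)
  \<comment> \<open>Row sums cancel term by term: mass leaves and enters the same row
    \<open>i k\<close>.\<close>
  have "D *v 1 = 0"
    by (simp add: D_def E_def matrix_vector_mult_diff_rdistrib sum_matrix_vector_mult
        unit_matrix_mult_one)
  moreover have "transpose D *v 1 = 0"
  proof -
    have "transpose D = (\<Sum>k=1..N. transpose (E (i k) (j (\<sigma> k)))) - (\<Sum>k=1..N. transpose (E (i k) (j k)))"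
      by (simp add: D_def vec_eq_iff transpose_def)
    \<comment> \<open>Column sums cancel only in total, by reindexing along the permutation.\<close>
    moreover have "(\<Sum>k=1..N. axis (j (\<sigma> k)) 1) = (\<Sum>k=1..N. axis (j k) (1::real))"
      using sum.permute[OF assms(8), of "\<lambda>k. axis (j k) (1::real)"] by (simp add: o_def)
    ultimately show ?thesis
      by (simp add: E_def transpose_unit_matrix matrix_vector_mult_diff_rdistrib
          sum_matrix_vector_mult unit_matrix_mult_one del: transpose_matrix_vector)
  qed
  moreover have "0 \<le> D $ u $ v" if "(u, v) \<notin> matrix_support P" for u v
  proof -
    \<comment> \<open>Mass is removed only at the cells \<open>(i k, j k)\<close>, all of which lie
      in the support.\<close>
    have "(\<Sum>k=1..N. E (i k) (j k) $ u $ v) = 0"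
      using assms(7) that by (intro sum.neutral) (auto simp: E_def axis_def)
    moreover have "0 \<le> (\<Sum>k=1..N. E (i k) (j (\<sigma> k)) $ u $ v)"
      by (intro sum_nonneg) (auto simp: E_def axis_def)
    ultimately show ?thesis
      by (simp add: D_def)
  qed
  ultimately have "0 \<le> C \<bullet> D"
    using optimal_coupling_first_order[OF assms(3,4)] assms(5) by simp
  then show ?thesis
    by (simp add: D_def inner_diff_right inner_sum_right inner_E)
qed

end
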